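(* Let $G$ be a finite non-abelian group, let $\chi$ be the character of an irreducible complex representation $\rho$ of $G$ of dimension $n>1$, and let $K$, $G_0$, $\gamma=\gamma_0>\gamma_1>\cdots>\gamma_l=0$, $C_0,\dots,C_l$ and $a_{1,t}$ be as defined in the context, with $\gamma>0$. Then for all $i=0,\dots,l$ and all real $t>0$, $$\gamma_i\;\le\;\left(\frac{a_{1,t}-n^{t}|K|/|G|}{(|C_0|+\cdots+|C_i|)/|G|}\right)^{1/t}.$$ In particular, if $\rho$ is faithful and $G$ has trivial center, then $$\gamma_i\;\le\;\left(\frac{|G|-n^{2}}{|C_0|+\cdots+|C_i|}\right)^{1/2},\qquad i=0,\dots,l,$$ and $$\sqrt{\frac{|G|-n^2}{|G|-|G_0|-1}}\;\le\;\gamma\;\le\;\sqrt{\frac{|G|-n^2}{|C_0|}}.$$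
   Context: $|\chi|$ denotes the function $g\mapsto|\chi(g)|$ on $G$. $K=\{g\in G:|\chi(g)|=n\}$ is the normal subgroup of elements acting by scalars. $G_0=\{g\in G:\chi(g)=0\}$. $n>\gamma=\gamma_0>\gamma_1>\cdots>\gamma_l=0$ is the list of all distinct values of $|\chi|$; it is a standing assumption that $\gamma>0$. $C_q=\{g\in G:|\chi(g)|=\gamma_q\}$ for $q=0,\dots,l$ (so $C_l=G_0$). For real $t>0$, $a_{1,t}=\frac{1}{|G|}\sum_{g\in G}|\chi(g)|^t$, the coefficient of the trivial character in the expansion of the class function $|\chi|^t$ in irreducible characters. *)

theory Defs
  imports Complex_Main "HOL-Algebra.Group" "Jordan_Normal_Form.Matrix" "Jordan_Normal_Form.VS_Connect"
begin

definition general_linear :: "nat \<Rightarrow> complex mat monoid" where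
  "general_linear n = units_of (ring_mat TYPE(complex) n ())"

definition representation :: "('a, 'b) monoid_scheme \<Rightarrow> nat \<Rightarrow> ('a \<Rightarrow> complex mat) \<Rightarrow> bool" where
  "representation G n \<rho> \<longleftrightarrow> \<rho> \<in> hom G (general_linear n)"

definition invariant_subspace ::
  "('a, 'b) monoid_scheme \<Rightarrow> nat \<Rightarrow> ('a \<Rightarrow> complex mat) \<Rightarrow> complex vec set \<Rightarrow> bool" where
  "invariant_subspace G n \<rho> W \<longleftrightarrow>
     VectorSpace.subspace class_ring W (module_vec TYPE(complex) n) \<and>
     (\<forall>g\<in>carrier G. \<forall>w\<in>W. \<rho> g *\<^sub>v w \<in> W)"

definition irreducible_representation ::
  "('a, 'b) monoid_scheme \<Rightarrow> nat \<Rightarrow> ('a \<Rightarrow> complex mat) \<Rightarrow> bool" where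
  "irreducible_representation G n \<rho> \<longleftrightarrow>
     representation G n \<rho> \<and> 0 < n \<and>
     (\<forall>W. invariant_subspace G n \<rho> W \<longrightarrow> W = {0\<^sub>v n} \<or> W = carrier_vec n)"

definition faithful :: "('a, 'b) monoid_scheme \<Rightarrow> ('a \<Rightarrow> complex mat) \<Rightarrow> bool" where
  "faithful G \<rho> \<longleftrightarrow> inj_on \<rho> (carrier G)"

definition mat_trace :: "complex mat \<Rightarrow> complex" where
  "mat_trace A = (\<Sum>i<dim_row A. A $$ (i, i))"

definition group_character :: "('a \<Rightarrow> complex mat) \<Rightarrow> 'a \<Rightarrow> complex" where
  "group_character \<rho> g = mat_trace (\<rho> g)"

definition center :: "('a, 'b) monoid_scheme \<Rightarrow> 'a set" where
  "center G = {z \<in> carrier G. \<forall>g\<in>carrier G. z \<otimes>\<^bsub>G\<^esub> g = g \<otimes>\<^bsub>G\<^esub> z}"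

definition level_set :: "('a, 'b) monoid_scheme \<Rightarrow> ('a \<Rightarrow> complex) \<Rightarrow> real \<Rightarrow> 'a set" where
  "level_set G \<chi> c = {g \<in> carrier G. cmod (\<chi> g) = c}"

text \<open>The elements acting by scalars: for a representation of dimension \<open>n\<close> of a finite group these are
  the \<open>g\<close> with \<open>|\<chi>(g)| = n\<close>.\<close>

definition scalar_subgroup :: "('a, 'b) monoid_scheme \<Rightarrow> ('a \<Rightarrow> complex) \<Rightarrow> nat \<Rightarrow> 'a set" where
  "scalar_subgroup G \<chi> n = level_set G \<chi> (real n)"

definition zero_set :: "('a, 'b) monoid_scheme \<Rightarrow> ('a \<Rightarrow> complex) \<Rightarrow> 'a set" where
  "zero_set G \<chi> = {g \<in> carrier G. \<chi> g = 0}"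

text \<open>\<open>n > \<gamma> 0 > \<dots> > \<gamma> l\<close> lists all distinct values of \<open>|\<chi>|\<close>.  That \<open>\<gamma> l = 0\<close> when \<open>\<chi>\<close> is
  irreducible of degree \<open>n > 1\<close> is Burnside's theorem on zeros of characters, so it is not
  imposed here.  Only \<open>\<gamma> 0, \<dots>, \<gamma> l\<close> are meaningful.\<close>

definition lists_abs_values ::
  "('a, 'b) monoid_scheme \<Rightarrow> ('a \<Rightarrow> complex) \<Rightarrow> nat \<Rightarrow> (nat \<Rightarrow> real) \<Rightarrow> nat \<Rightarrow> bool" where
  "lists_abs_values G \<chi> n \<gamma> l \<longleftrightarrow>
     real n > \<gamma> 0 \<and>
     (\<forall>i j. i < j \<and> j \<le> l \<longrightarrow> \<gamma> i > \<gamma> j) \<and>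
     (\<lambda>g. cmod (\<chi> g)) ` carrier G = insert (real n) (\<gamma> ` {..l})"

text \<open>The coefficient of the trivial character in the class function \<open>|\<chi>|\<^sup>t\<close>, for \<open>t > 0\<close>
  (so that \<open>0 powr t = 0\<close> is the intended value at zeros of \<open>\<chi>\<close>).\<close>

definition trivial_coeff :: "('a, 'b) monoid_scheme \<Rightarrow> ('a \<Rightarrow> complex) \<Rightarrow> real \<Rightarrow> real" where
  "trivial_coeff G \<chi> t = (\<Sum>g\<in>carrier G. cmod (\<chi> g) powr t) / real (card (carrier G))"

end

theory Submission
  imports Defs "Jordan_Normal_Form.Schur_Decomposition" "Jordan_Normal_Form.Spectral_Radius"
    "HOL-Algebra.Multiplicative_Group"
begin

text \<open>
  The first bound is Markov's inequality for \<open>|\<chi>|\<^sup>t\<close>.  In the sum of \<open>|\<chi>(g)|\<^sup>t\<close> over the group,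
  the set \<open>K\<close> contributes \<open>n\<^sup>t |K|\<close>, and every element of \<open>C 0 \<union> \<dots> \<union> C i\<close> contributes at least
  \<open>(\<gamma> i)\<^sup>t\<close>.  These sets are pairwise disjoint, so \<open>(\<gamma> i)\<^sup>t\<close> times the total size of the \<open>C q\<close> is at
  most the full sum minus \<open>n\<^sup>t |K|\<close> (\<open>sum_powr_level_sets_le\<close>); dividing and taking a \<open>t\<close>-th root gives
  the claim.

  The remaining bounds are the case \<open>t = 2\<close>, where two facts on representations make the constants
  explicit.  The sum of \<open>|\<chi>(g)|\<^sup>2\<close> is \<open>|G|\<close>, by orthogonality (\<open>sum_norm_character_squared\<close>), and
  \<open>K = {1}\<close> when the representation is faithful and the centre is trivial
  (\<open>scalar_subgroup_trivial\<close>).  The lower bound for \<open>\<gamma> 0\<close> reads the same sum in the other direction: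
  outside \<open>K = {1}\<close> and the zeros of \<open>\<chi>\<close> every summand is at most \<open>(\<gamma> 0)\<^sup>2\<close>
  (\<open>sum_squares_le_max_level\<close>).

  Both facts rest on matrices of finite order.  Such a matrix is similar to an upper triangular one
  whose diagonal consists of roots of unity, so the trace of the inverse is the conjugate of the trace
  (\<open>mat_trace_pow_pred\<close>), and a trace of modulus \<open>n\<close> forces a scalar matrix
  (\<open>scalar_if_norm_trace_maximal\<close>).  Orthogonality then follows from Schur's lemma, applied to matrix
  units averaged over the group.
\<close>

section \<open>Trace and diagonal of square matrices\<close>

lemma mult_mat_entry:
  assumes "A \<in> carrier_mat n n" "B \<in> carrier_mat n n" "i < n" "j < n"
  shows "(A * B) $$ (i, j) = (\<Sum>k<n. A $$ (i, k) * B $$ (k, j))"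
  using assms by (auto simp: scalar_prod_def atLeast0LessThan intro!: sum.cong)

lemma mat_trace_mult_commute:
  assumes "A \<in> carrier_mat n n" "B \<in> carrier_mat n n"
  shows "mat_trace (A * B) = mat_trace (B * A)"
proof -
  have "mat_trace (A * B) = (\<Sum>i<n. \<Sum>k<n. A $$ (i, k) * B $$ (k, i))"
    using assms unfolding mat_trace_def
    by (intro sum.cong) (auto simp: mult_mat_entry[OF assms] simp del: index_mult_mat(1))
  also have "\<dots> = (\<Sum>k<n. \<Sum>i<n. B $$ (k, i) * A $$ (i, k))"
    by (subst sum.swap) (simp add: mult.commute)
  also have "\<dots> = mat_trace (B * A)"
    using assms unfolding mat_trace_def
    by (intro sum.cong) (auto simp: mult_mat_entry[OF assms(2,1)] simp del: index_mult_mat(1))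
  finally show ?thesis .
qed

lemma mat_trace_similar:
  assumes "similar_mat_wit A B P Q"
  shows "mat_trace A = mat_trace B"
proof -
  note D = similar_mat_witD[OF refl assms]
  have "mat_trace A = mat_trace ((P * B) * Q)" using D(3) by (rule arg_cong)
  also have "\<dots> = mat_trace (Q * (P * B))"
    by (rule mat_trace_mult_commute[OF mult_carrier_mat[OF D(6,5)] D(7)])
  also have "Q * (P * B) = (Q * P) * B"
    by (rule assoc_mult_mat[OF D(7,6,5), symmetric])
  also have "\<dots> = B" unfolding D(2) by (rule left_mult_one_mat[OF D(5)])
  finally show ?thesis .
qed

lemma upper_triangular_mult:
  assumes A: "A \<in> carrier_mat n n" "upper_triangular A"
    and B: "B \<in> carrier_mat n n" "upper_triangular (B :: 'a :: semiring_0 mat)"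
  shows "upper_triangular (A * B)"
    and "i < n \<Longrightarrow> (A * B) $$ (i, i) = A $$ (i, i) * B $$ (i, i)"
proof -
  have z: "A $$ (i, k) * B $$ (k, j) = 0" if "i < n" "k < n" "j < n" "k < i \<or> j < k" for i j k
    using that A B by (auto simp: upper_triangular_def)
  show "upper_triangular (A * B)"
  proof (rule upper_triangularI)
    fix i j assume ij: "j < i" "i < dim_row (A * B)"
    then have "(A * B) $$ (i, j) = (\<Sum>k<n. A $$ (i, k) * B $$ (k, j))"
      using A B by (intro mult_mat_entry) auto
    also have "\<dots> = 0"
      using ij A by (intro sum.neutral ballI z) auto
    finally show "(A * B) $$ (i, j) = 0" .
  qed
  show "(A * B) $$ (i, i) = A $$ (i, i) * B $$ (i, i)" if i: "i < n"
  proof -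
    have "(A * B) $$ (i, i) = (\<Sum>k<n. A $$ (i, k) * B $$ (k, i))"
      using A B i by (intro mult_mat_entry) auto
    also have "\<dots> = (\<Sum>k\<in>{i}. A $$ (i, k) * B $$ (k, i))"
      using i by (intro sum.mono_neutral_right ballI z) auto
    finally show ?thesis by simp
  qed
qed

lemma upper_triangular_pow:
  assumes "B \<in> carrier_mat n n" "upper_triangular (B :: 'a :: comm_semiring_1 mat)"
  shows "upper_triangular (B ^\<^sub>m k)"
    and "i < n \<Longrightarrow> (B ^\<^sub>m k) $$ (i, i) = (B $$ (i, i)) ^ k"
proof -
  have "upper_triangular (B ^\<^sub>m k) \<and> (\<forall>i<n. (B ^\<^sub>m k) $$ (i, i) = (B $$ (i, i)) ^ k)"
  proof (induction k)
    case 0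
    then show ?case using assms by auto
  next
    case (Suc k)
    then show ?case
      using upper_triangular_mult[of "B ^\<^sub>m k" n B] assms
      by (simp add: mult.commute del: index_mult_mat(1))
  qed
  then show "upper_triangular (B ^\<^sub>m k)" "i < n \<Longrightarrow> (B ^\<^sub>m k) $$ (i, i) = (B $$ (i, i)) ^ k"
    by auto
qed

section \<open>Complex matrices of finite order\<close>

text \<open>
  A Schur triangularization of a matrix of finite order inherits the order, since similarity commutes
  with powers; comparing diagonals shows that the eigenvalues are roots of unity.
\<close>
lemma finite_order_triangularize:
  fixes A :: "complex mat"
  assumes A: "A \<in> carrier_mat n n" and m: "A ^\<^sub>m m = 1\<^sub>m n"
  obtains B P Q where "similar_mat_wit A B P Q" "B \<in> carrier_mat n n" "upper_triangular B"
    "B ^\<^sub>m m = 1\<^sub>m n" "\<And>i. i < n \<Longrightarrow> (B $$ (i, i)) ^ m = 1"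
proof -
  obtain es where "char_poly A = (\<Prod>a\<leftarrow>es. [:- a, 1:])"
    using char_poly_factorized[OF A] by blast
  from schur_decomposition_exists[OF A this] obtain B P Q
    where B: "B \<in> carrier_mat n n" "upper_triangular B" and sim: "similar_mat_wit A B P Q"
    unfolding similar_mat_def by blast
  note D = similar_mat_witD2[OF A sim]
  have "B ^\<^sub>m m = Q * A ^\<^sub>m m * P"
    using similar_mat_wit_pow_id[OF similar_mat_wit_sym[OF sim]] .
  also have "\<dots> = 1\<^sub>m n" using D(1,2,4-) m by simp
  finally have pow: "B ^\<^sub>m m = 1\<^sub>m n" .
  have "(B $$ (i, i)) ^ m = 1" if "i < n" for i
    using upper_triangular_pow(2)[OF B that, of m] pow that by simp
  with sim B pow show ?thesis by (rule that)
qed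

lemma norm_eq_1_if_power_eq_1:
  fixes z :: complex
  assumes "z ^ m = 1" "m > 0"
  shows "cmod z = 1"
proof -
  have "cmod z ^ m = 1" using arg_cong[OF assms(1), of cmod] by (simp add: norm_power)
  then show ?thesis using power_eq_imp_eq_base[of "cmod z" m 1] assms(2) by simp
qed

text \<open>
  The power \<open>A\<^sup>m\<^sup>-\<^sup>1\<close> is the inverse of \<open>A\<close>, and inverting an eigenvalue on the unit circle means
  conjugating it.
\<close>
lemma mat_trace_pow_pred:
  assumes A: "A \<in> carrier_mat n n" and "A ^\<^sub>m m = 1\<^sub>m n" and m: "m > 0"
  shows "mat_trace (A ^\<^sub>m (m - 1)) = cnj (mat_trace A)"
proof -
  obtain B P Q where B: "similar_mat_wit A B P Q" "B \<in> carrier_mat n n" "upper_triangular B"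
    and d: "\<And>i. i < n \<Longrightarrow> (B $$ (i, i)) ^ m = 1"
    using finite_order_triangularize[OF assms(1,2)] by metis
  have "(B $$ (i, i)) ^ (m - 1) = cnj (B $$ (i, i))" if "i < n" for i
  proof -
    let ?z = "B $$ (i, i)"
    have "?z * cnj ?z = 1"
      using norm_eq_1_if_power_eq_1[OF d[OF that] m] by (simp add: complex_norm_square[symmetric])
    moreover have "?z * ?z ^ (m - 1) = 1" using d[OF that] m by (cases m) auto
    ultimately show ?thesis by (metis mult_left_cancel mult_zero_left zero_neq_one)
  qed
  then have "mat_trace (B ^\<^sub>m (m - 1)) = cnj (mat_trace B)"
    using B upper_triangular_pow(2)[OF B(2,3)] unfolding mat_trace_def by simp
  then show ?thesis
    using mat_trace_similar[OF B(1)] mat_trace_similar[OF similar_mat_wit_pow[OF B(1)], of "m - 1"]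
    by simp
qed

text \<open>
  The equality case of the triangle inequality: after multiplication by the conjugate of the mean
  \<open>u\<close>, which has modulus one, the real parts are at most \<open>1\<close> and add up to \<open>n\<close>, so all of them equal \<open>1\<close>.
\<close>
lemma unit_sum_norm_eq_card_imp_const:
  fixes z :: "nat \<Rightarrow> complex"
  assumes z: "\<And>i. i < n \<Longrightarrow> cmod (z i) = 1" and s: "cmod (\<Sum>i<n. z i) = real n" and i: "i < n"
  shows "z i = (\<Sum>i<n. z i) / of_nat n"
proof -
  define u where "u = (\<Sum>i<n. z i) / of_nat n"
  have u1: "cmod u = 1" using s i by (simp add: u_def norm_divide)
  have le: "Re (cnj u * z j) \<le> 1" if "j < n" for j
    using complex_Re_le_cmod[of "cnj u * z j"] u1 z[OF that] by (simp add: norm_mult del: complex_Re_le_cmod)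
  have "(\<Sum>j<n. cnj u * z j) = of_nat n * (u * cnj u)"
    unfolding sum_distrib_left[symmetric] using i by (simp add: u_def)
  also have "u * cnj u = 1" using u1 by (simp add: complex_norm_square[symmetric])
  finally have "(\<Sum>j<n. cnj u * z j) = of_nat n" by simp
  then have "(\<Sum>j<n. Re (cnj u * z j)) = n" by (metis Re_sum Re_complex_of_real of_real_of_nat_eq)
  then have "(\<Sum>j<n. 1 - Re (cnj u * z j)) = 0" by (simp add: sum_subtractf del: times_complex.sel)
  then have "Re (cnj u * z i) = 1"
    using i le by (subst (asm) sum_nonneg_eq_0_iff) (auto simp del: times_complex.sel)
  moreover have "cmod (cnj u * z i) = 1" using u1 z[OF i] by (simp add: norm_mult)
  ultimately have "cnj u * z i = 1"
    by (simp add: complex_eq_iff cmod_def del: times_complex.sel)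
  then have "u * cnj u * z i = u" by (simp add: mult.assoc)
  then show ?thesis using \<open>u * cnj u = 1\<close> by (simp add: u_def)
qed

text \<open>
  A nontrivial unipotent matrix has infinite order in characteristic zero.  On the superdiagonals
  nearest to the diagonal on which \<open>B\<close> does not vanish, taking the \<open>k\<close>-th power multiplies the entries by
  \<open>k d\<^sup>k\<^sup>-\<^sup>1\<close>, and at \<open>k = m\<close> the result must be an entry of the identity matrix.  The superdiagonals are
  therefore cleared one after another, by induction on \<open>j - i\<close>.
\<close>
lemma upper_triangular_const_diag_finite_order:
  fixes B :: "complex mat"
  assumes B: "B \<in> carrier_mat n n" "upper_triangular B"
    and diag: "\<And>i. i < n \<Longrightarrow> B $$ (i, i) = d"
    and pow: "B ^\<^sub>m m = 1\<^sub>m n" and m: "m > 0"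
  shows "B = d \<cdot>\<^sub>m 1\<^sub>m n"
proof -
  have off: "B $$ (i, j) = 0" if "i < j" "j < n" for i j
    using that
  proof (induction "j - i" arbitrary: i j rule: less_induct)
    case less
    have "d ^ m = 1"
      using upper_triangular_pow(2)[OF B, of i m] pow diag[of i] less.prems by simp
    then have d0: "d \<noteq> 0" using m by (auto simp: power_0_left)
    have pk: "(B ^\<^sub>m k) \<in> carrier_mat n n" for k using B by simp
    have "(B ^\<^sub>m k) $$ (i, j) = of_nat k * d ^ (k - 1) * B $$ (i, j)" for k
    proof (induction k)
      case 0
      then show ?case using B less.prems by simp
    next
      case (Suc k)
      \<comment> \<open>For \<open>p\<close> strictly between \<open>i\<close> and \<open>j\<close>, the second factor is nearer to the diagonal: it vanishes by induction.\<close>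
      have z: "(B ^\<^sub>m k) $$ (i, p) * B $$ (p, j) = 0" if "p < n" "p \<noteq> i" "p \<noteq> j" for p
      proof -
        consider "p < i" | "i < p" "p < j" | "j < p" using \<open>p \<noteq> i\<close> \<open>p \<noteq> j\<close> by linarith
        then show ?thesis
        proof cases
          case 1
          then show ?thesis
            using upper_triangular_pow(1)[OF B, of k] less.prems B by (auto simp: upper_triangular_def)
        next
          case 2
          then show ?thesis using less.hyps[of j p] less.prems by simp
        next
          case 3
          then show ?thesis using B that by (auto simp: upper_triangular_def)
        qed
      qed
      have "(B ^\<^sub>m Suc k) $$ (i, j) = (\<Sum>p<n. (B ^\<^sub>m k) $$ (i, p) * B $$ (p, j))"
        using mult_mat_entry[OF pk B(1)] less.prems by simp
      also have "\<dots> = (\<Sum>p\<in>{i, j}. (B ^\<^sub>m k) $$ (i, p) * B $$ (p, j))"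
        using less.prems z by (intro sum.mono_neutral_right) auto
      also have "\<dots> = d ^ k * B $$ (i, j) + of_nat k * d ^ (k - 1) * B $$ (i, j) * d"
        using less.prems Suc.IH upper_triangular_pow(2)[OF B, of i k] diag by simp
      also have "\<dots> = of_nat (Suc k) * d ^ (Suc k - 1) * B $$ (i, j)"
        by (cases k) (simp_all add: algebra_simps)
      finally show ?case .
    qed
    from this[of m] pow less.prems have "of_nat m * d ^ (m - 1) * B $$ (i, j) = 0" by simp
    then show ?case using m d0 by simp
  qed
  show ?thesis
  proof (rule eq_matI)
    fix i j assume "i < dim_row (d \<cdot>\<^sub>m 1\<^sub>m n)" "j < dim_col (d \<cdot>\<^sub>m 1\<^sub>m n)"
    then show "B $$ (i, j) = (d \<cdot>\<^sub>m 1\<^sub>m n) $$ (i, j)"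
      using off[of i j] diag[of i] B by (cases i j rule: linorder_cases) (auto simp: upper_triangular_def)
  qed (use B in auto)
qed

text \<open>
  By the equality case of the triangle inequality all eigenvalues coincide, so the triangular form is
  scalar, and a scalar matrix is unchanged by conjugation.
\<close>
lemma scalar_if_norm_trace_maximal:
  assumes A: "A \<in> carrier_mat n n" and Am: "A ^\<^sub>m m = 1\<^sub>m n" and m: "m > 0"
    and tr: "cmod (mat_trace A) = real n"
  shows "\<exists>d. A = d \<cdot>\<^sub>m 1\<^sub>m n"
proof -
  obtain B P Q where sim: "similar_mat_wit A B P Q" and B: "B \<in> carrier_mat n n" "upper_triangular B"
    and pow: "B ^\<^sub>m m = 1\<^sub>m n" and d: "\<And>i. i < n \<Longrightarrow> (B $$ (i, i)) ^ m = 1"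
    using finite_order_triangularize[OF A Am] by metis
  define u where "u = (\<Sum>i<n. B $$ (i, i)) / of_nat n"
  have "cmod (\<Sum>i<n. B $$ (i, i)) = real n"
    using mat_trace_similar[OF sim] tr B unfolding mat_trace_def by simp
  then have "B $$ (i, i) = u" if "i < n" for i
    unfolding u_def using unit_sum_norm_eq_card_imp_const[of n "\<lambda>i. B $$ (i, i)" i]
      norm_eq_1_if_power_eq_1[OF d m] that by blast
  from upper_triangular_const_diag_finite_order[OF B this pow m] have B1: "B = u \<cdot>\<^sub>m 1\<^sub>m n" .
  note D = similar_mat_witD2[OF A sim]
  have "A = P * B * Q" by (rule D(3))
  also have "\<dots> = u \<cdot>\<^sub>m (P * Q)"
    unfolding B1 using D(6,7)
    by (simp add: mult_smult_distrib[OF D(6) one_carrier_mat] mult_smult_assoc_mat[OF D(6,7)])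
  also have "\<dots> = u \<cdot>\<^sub>m 1\<^sub>m n" using D(1) by simp
  finally show ?thesis by blast
qed

section \<open>Orthogonality for irreducible representations\<close>

lemma representation_carrier:
  assumes "representation G n \<rho>" "g \<in> carrier G"
  shows "\<rho> g \<in> carrier_mat n n"
  using assms unfolding representation_def general_linear_def hom_def units_of_def Units_def
  by (auto simp: ring_mat_simps)

lemma representation_mult:
  assumes "representation G n \<rho>" "g \<in> carrier G" "h \<in> carrier G"
  shows "\<rho> (g \<otimes>\<^bsub>G\<^esub> h) = \<rho> g * \<rho> h"
  using assms unfolding representation_def general_linear_def hom_def units_of_def
  by (auto simp: ring_mat_simps)

lemma representation_one:
  assumes "group G" "representation G n \<rho>"
  shows "\<rho> \<one>\<^bsub>G\<^esub> = 1\<^sub>m n"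
proof -
  interpret R: ring "ring_mat TYPE(complex) n ()" by (rule ring_mat)
  have "group (general_linear n)" unfolding general_linear_def by (rule R.units_group)
  then have "\<rho> \<one>\<^bsub>G\<^esub> = \<one>\<^bsub>general_linear n\<^esub>"
    using assms unfolding representation_def by (intro hom_one) auto
  then show ?thesis by (simp add: general_linear_def units_of_def ring_mat_simps)
qed

lemma representation_pow:
  assumes "group G" "representation G n \<rho>" "g \<in> carrier G"
  shows "\<rho> (g [^]\<^bsub>G\<^esub> (k :: nat)) = \<rho> g ^\<^sub>m k"
proof (induction k)
  case 0
  then show ?case using representation_one[OF assms(1,2)] representation_carrier[OF assms(2,3)]
    by (simp add: carrier_matD)
next
  case (Suc k)
  interpret group G by fact
  show ?case using Suc representation_mult[OF assms(2) _ assms(3)] assms(3) by simp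
qed

lemma representation_finite_order:
  assumes "group G" "finite (carrier G)" "representation G n \<rho>" "g \<in> carrier G"
  shows "\<rho> g ^\<^sub>m Coset.order G = 1\<^sub>m n"
  using representation_pow[OF assms(1,3,4), of "Coset.order G"] representation_one[OF assms(1,3)]
    group.pow_order_eq_1[OF assms(1,4)] by simp

text \<open>
  With \<open>m = |G|\<close>, the inverse of \<open>g\<close> is \<open>g\<^sup>m\<^sup>-\<^sup>1\<close>, so that the statement on matrices of finite order applies.
\<close>
lemma group_character_inv:
  assumes G: "group G" "finite (carrier G)" and \<rho>: "representation G n \<rho>" and g: "g \<in> carrier G"
  shows "group_character \<rho> (inv\<^bsub>G\<^esub> g) = cnj (group_character \<rho> g)"
proof -
  interpret group G by fact
  have o: "Coset.order G > 0" using G order_gt_0_iff_finite by blast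
  have "g [^]\<^bsub>G\<^esub> (Coset.order G - 1) \<otimes>\<^bsub>G\<^esub> g = \<one>\<^bsub>G\<^esub>"
    using pow_order_eq_1[OF g] o by (metis Suc_pred' nat_pow_Suc)
  then have "inv\<^bsub>G\<^esub> g = g [^]\<^bsub>G\<^esub> (Coset.order G - 1)" using g by (intro inv_equality) auto
  then show ?thesis
    using mat_trace_pow_pred[OF representation_carrier[OF \<rho> g] representation_finite_order[OF G \<rho> g] o]
      representation_pow[OF G(1) \<rho> g] by (simp add: group_character_def)
qed

lemma invariant_subspace_eigenspace:
  assumes \<rho>: "representation G n \<rho>" and T: "T \<in> carrier_mat n n"
    and comm: "\<And>g. g \<in> carrier G \<Longrightarrow> \<rho> g * T = T * \<rho> g"
  shows "invariant_subspace G n \<rho> {v \<in> carrier_vec n. T *\<^sub>v v = c \<cdot>\<^sub>v v}" (is "invariant_subspace G n \<rho> ?W")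
proof -
  interpret V: vec_space "TYPE(complex)" n .
  have "LinearCombinations.submodule class_ring ?W (module_vec TYPE(complex) n)"
  proof (rule LinearCombinations.submodule.intro)
    show "Module.module class_ring (module_vec TYPE(complex) n)" by (rule vec_module)
  next
    fix v w assume vw: "v \<in> ?W" "w \<in> ?W"
    then have "T *\<^sub>v (v + w) = c \<cdot>\<^sub>v (v + w)"
      using T by (simp add: mult_add_distrib_mat_vec[OF T] smult_add_distrib_vec[of _ n])
    then show "v \<oplus>\<^bsub>module_vec TYPE(complex) n\<^esub> w \<in> ?W"
      using vw by (simp add: module_vec_simps)
  next
    fix a v assume v: "v \<in> ?W"
    then have "T *\<^sub>v (a \<cdot>\<^sub>v v) = c \<cdot>\<^sub>v (a \<cdot>\<^sub>v v)"
      using T by (simp add: mult_mat_vec[OF T] smult_smult_assoc mult.commute)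
    then show "a \<odot>\<^bsub>module_vec TYPE(complex) n\<^esub> v \<in> ?W"
      using v by (simp add: module_vec_simps)
  next
    show "\<zero>\<^bsub>module_vec TYPE(complex) n\<^esub> \<in> ?W"
      using T by (auto simp: module_vec_simps)
  qed (auto simp: module_vec_simps)
  then have "VectorSpace.subspace class_ring ?W (module_vec TYPE(complex) n)"
    unfolding VectorSpace.subspace_def using V.vectorspace_axioms by blast
  moreover have "\<rho> g *\<^sub>v v \<in> ?W" if g: "g \<in> carrier G" and v: "v \<in> ?W" for g v
  proof -
    note R = representation_carrier[OF \<rho> g]
    have "T *\<^sub>v (\<rho> g *\<^sub>v v) = (T * \<rho> g) *\<^sub>v v" using v T R by simp
    also have "\<dots> = \<rho> g *\<^sub>v (T *\<^sub>v v)" using v T R comm[OF g, symmetric] by simp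
    also have "\<dots> = c \<cdot>\<^sub>v (\<rho> g *\<^sub>v v)" using v R by (simp add: mult_mat_vec[OF R])
    finally show ?thesis using v R by auto
  qed
  ultimately show ?thesis unfolding invariant_subspace_def by blast
qed

text \<open>
  Over the complex numbers an intertwiner has an eigenvector.  The eigenspace is invariant and nonzero,
  hence the whole space.
\<close>
lemma schur_lemma:
  assumes irr: "irreducible_representation G n \<rho>" and T: "T \<in> carrier_mat n n"
    and comm: "\<And>g. g \<in> carrier G \<Longrightarrow> \<rho> g * T = T * \<rho> g"
  obtains c where "T = c \<cdot>\<^sub>m 1\<^sub>m n"
proof -
  have \<rho>: "representation G n \<rho>" and n: "n > 0"
    using irr unfolding irreducible_representation_def by auto
  obtain c v where v: "v \<in> carrier_vec n" "v \<noteq> 0\<^sub>v n" "T *\<^sub>v v = c \<cdot>\<^sub>v v"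
    using spectrum_non_empty[OF T n] T unfolding spectrum_def eigenvalue_def eigenvector_def by auto
  let ?W = "{v \<in> carrier_vec n. T *\<^sub>v v = c \<cdot>\<^sub>v v}"
  have "invariant_subspace G n \<rho> ?W" by (rule invariant_subspace_eigenspace[OF \<rho> T comm])
  then have "?W = carrier_vec n"
    using irr v unfolding irreducible_representation_def by blast
  then have *: "T *\<^sub>v unit_vec n j = c \<cdot>\<^sub>v unit_vec n j" for j
    using unit_vec_carrier by blast
  have "T = c \<cdot>\<^sub>m 1\<^sub>m n"
  proof (rule eq_matI)
    fix i j assume ij: "i < dim_row (c \<cdot>\<^sub>m 1\<^sub>m n)" "j < dim_col (c \<cdot>\<^sub>m 1\<^sub>m n)"
    then have "T $$ (i, j) = (T *\<^sub>v unit_vec n j) $ i" using T by simp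
    then show "T $$ (i, j) = (c \<cdot>\<^sub>m 1\<^sub>m n) $$ (i, j)" using *[of j] ij by simp
  qed (use T in auto)
  then show ?thesis by (rule that)
qed

text \<open>
  Schur orthogonality within one representation.  For fixed \<open>j\<close> and \<open>k\<close>, the sums on the left, as \<open>i\<close>
  and \<open>l\<close> vary, are the entries of the sum over \<open>g\<close> of \<open>\<rho>(g) E \<rho>(g\<^sup>-\<^sup>1)\<close>, where \<open>E\<close> is the matrix unit at
  position \<open>(j, k)\<close>.  Averaging makes this matrix an intertwiner, so it is a scalar \<open>c\<close>, and its trace
  \<open>n c\<close> equals \<open>|G|\<close> times the trace of \<open>E\<close>.
\<close>
lemma sum_matrix_coefficients:
  fixes G (structure)
  assumes G: "group G" "finite (carrier G)" and irr: "irreducible_representation G n \<rho>"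
    and "i < n" "j < n" "k < n" "l < n"
  shows "(\<Sum>g\<in>carrier G. \<rho> g $$ (i, j) * \<rho> (inv g) $$ (k, l))
           = (if i = l \<and> j = k then of_nat (card (carrier G)) / of_nat n else 0)"
proof -
  interpret group G by fact
  have \<rho>: "representation G n \<rho>" using irr unfolding irreducible_representation_def by auto
  note R = representation_carrier[OF \<rho>] and M = representation_mult[OF \<rho>]
  define T where "T = mat n n (\<lambda>(i, l). \<Sum>g\<in>carrier G. \<rho> g $$ (i, j) * \<rho> (inv g) $$ (k, l))"
  have T: "T \<in> carrier_mat n n" by (simp add: T_def)
  have "\<rho> h * T = T * \<rho> h" if h: "h \<in> carrier G" for h
  proof (rule eq_matI)
    fix p q assume "p < dim_row (T * \<rho> h)" "q < dim_col (T * \<rho> h)"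
    then have pq: "p < n" "q < n" using T R[OF h] by auto
    have "(\<rho> h * T) $$ (p, q)
        = (\<Sum>g\<in>carrier G. (\<Sum>r<n. \<rho> h $$ (p, r) * \<rho> g $$ (r, j)) * \<rho> (inv g) $$ (k, q))"
      unfolding mult_mat_entry[OF R[OF h] T pq] sum_distrib_right
      by (subst sum.swap) (use pq in \<open>auto simp: T_def sum_distrib_left mult.assoc intro!: sum.cong\<close>)
    also have "\<dots> = (\<Sum>g\<in>carrier G. \<rho> (h \<otimes> g) $$ (p, j) * \<rho> (inv g) $$ (k, q))"
      using mult_mat_entry[OF R[OF h] R] pq \<open>j < n\<close> M[OF h] by (intro sum.cong) auto
    \<comment> \<open>Substitute \<open>inv h \<otimes> g\<close> for \<open>g\<close>: this moves \<open>h\<close> from the left factor to the right one.\<close>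
    also have "\<dots> = (\<Sum>g\<in>carrier G. \<rho> g $$ (p, j) * \<rho> (inv g \<otimes> h) $$ (k, q))"
      by (rule sum.reindex_bij_witness[of _ "\<lambda>g. inv h \<otimes> g" "\<lambda>g. h \<otimes> g"])
        (use h in \<open>auto simp: m_assoc[symmetric] inv_mult_group\<close>, use h in \<open>auto simp: m_assoc\<close>)
    also have "\<dots> = (\<Sum>g\<in>carrier G. \<rho> g $$ (p, j) * (\<Sum>r<n. \<rho> (inv g) $$ (k, r) * \<rho> h $$ (r, q)))"
      using mult_mat_entry[OF R R[OF h]] pq \<open>k < n\<close> M[OF _ h] by (intro sum.cong) auto
    also have "\<dots> = (T * \<rho> h) $$ (p, q)"
      unfolding mult_mat_entry[OF T R[OF h] pq] sum_distrib_left
      by (subst sum.swap) (use pq in \<open>auto simp: T_def sum_distrib_right mult.assoc intro!: sum.cong\<close>)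
    finally show "(\<rho> h * T) $$ (p, q) = (T * \<rho> h) $$ (p, q)" .
  qed (use T R[OF h] in auto)
  then obtain c where c: "T = c \<cdot>\<^sub>m 1\<^sub>m n" using schur_lemma[OF irr T] by blast
  have "of_nat n * c = (\<Sum>p<n. T $$ (p, p))" by (simp add: c)
  also have "\<dots> = (\<Sum>g\<in>carrier G. \<Sum>p<n. \<rho> (inv g) $$ (k, p) * \<rho> g $$ (p, j))"
    by (subst sum.swap) (auto simp: T_def mult.commute intro!: sum.cong)
  also have "\<dots> = (\<Sum>g\<in>carrier G. 1\<^sub>m n $$ (k, j))"
  proof (rule sum.cong[OF refl])
    fix g assume g: "g \<in> carrier G"
    have "(\<Sum>p<n. \<rho> (inv g) $$ (k, p) * \<rho> g $$ (p, j)) = (\<rho> (inv g) * \<rho> g) $$ (k, j)"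
      using g R \<open>k < n\<close> \<open>j < n\<close> by (intro mult_mat_entry[symmetric]) auto
    also have "\<rho> (inv g) * \<rho> g = 1\<^sub>m n"
      using M[of "inv g" g] g representation_one[OF G(1) \<rho>] by simp
    finally show "(\<Sum>p<n. \<rho> (inv g) $$ (k, p) * \<rho> g $$ (p, j)) = 1\<^sub>m n $$ (k, j)" .
  qed
  also have "\<dots> = (if j = k then of_nat (card (carrier G)) else 0)"
    using \<open>k < n\<close> \<open>j < n\<close> by auto
  finally have "c = (if j = k then of_nat (card (carrier G)) / of_nat n else 0)"
    using \<open>k < n\<close> by (auto simp: field_simps)
  moreover have "T $$ (i, l) = (if i = l then c else 0)" using c \<open>i < n\<close> \<open>l < n\<close> by simp
  moreover have "T $$ (i, l) = (\<Sum>g\<in>carrier G. \<rho> g $$ (i, j) * \<rho> (inv g) $$ (k, l))"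
    using \<open>i < n\<close> \<open>l < n\<close> by (simp add: T_def)
  ultimately show ?thesis by auto
qed

text \<open>
  Write \<open>|\<chi>(g)|\<^sup>2 = \<chi>(g) \<chi>(g\<^sup>-\<^sup>1)\<close> and expand both traces.  By orthogonality only the \<open>n\<close> terms with equal
  diagonal positions survive, each contributing \<open>|G| / n\<close>.
\<close>
lemma sum_norm_character_squared:
  assumes G: "group G" "finite (carrier G)" and irr: "irreducible_representation G n \<rho>"
  shows "(\<Sum>g\<in>carrier G. (cmod (group_character \<rho> g))\<^sup>2) = real (card (carrier G))"
proof -
  interpret group G by fact
  have \<rho>: "representation G n \<rho>" and n: "n > 0"
    using irr unfolding irreducible_representation_def by auto
  have tr: "group_character \<rho> g = (\<Sum>i<n. \<rho> g $$ (i, i))" if "g \<in> carrier G" for g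
    using representation_carrier[OF \<rho> that] by (simp add: group_character_def mat_trace_def)
  have "complex_of_real (\<Sum>g\<in>carrier G. (cmod (group_character \<rho> g))\<^sup>2)
      = (\<Sum>g\<in>carrier G. group_character \<rho> g * group_character \<rho> (inv\<^bsub>G\<^esub> g))"
    using group_character_inv[OF G \<rho>] by (simp add: complex_norm_square flip: of_real_power)
  also have "\<dots> = (\<Sum>g\<in>carrier G. \<Sum>i<n. \<Sum>k<n. \<rho> g $$ (i, i) * \<rho> (inv\<^bsub>G\<^esub> g) $$ (k, k))"
    by (intro sum.cong) (auto simp: tr sum_product)
  also have "\<dots> = (\<Sum>i<n. \<Sum>k<n. \<Sum>g\<in>carrier G. \<rho> g $$ (i, i) * \<rho> (inv\<^bsub>G\<^esub> g) $$ (k, k))"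
    by (subst sum.swap, intro sum.cong refl, subst sum.swap, rule refl)
  also have "\<dots> = (\<Sum>i<n. \<Sum>k<n. if i = k then of_nat (card (carrier G)) / of_nat n else 0)"
    using sum_matrix_coefficients[OF G irr] by (intro sum.cong) auto
  also have "\<dots> = complex_of_real (real (card (carrier G)))" using n by simp
  finally show ?thesis by (simp only: of_real_eq_iff)
qed

text \<open>
  An element of \<open>K\<close> acts by a scalar matrix, which commutes with every \<open>\<rho>(h)\<close>; faithfulness carries this
  back to the group, so the element is central.
\<close>
lemma scalar_subgroup_trivial:
  assumes G: "group G" "finite (carrier G)" and irr: "irreducible_representation G n \<rho>"
    and "faithful G \<rho>" and "center G = {\<one>\<^bsub>G\<^esub>}"
  shows "scalar_subgroup G (group_character \<rho>) n \<subseteq> {\<one>\<^bsub>G\<^esub>}"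
proof
  interpret group G by fact
  fix g assume "g \<in> scalar_subgroup G (group_character \<rho>) n"
  then have g: "g \<in> carrier G" and tr: "cmod (mat_trace (\<rho> g)) = real n"
    by (auto simp: scalar_subgroup_def level_set_def group_character_def)
  have \<rho>: "representation G n \<rho>" using irr unfolding irreducible_representation_def by auto
  have "Coset.order G > 0" using G order_gt_0_iff_finite by blast
  from scalar_if_norm_trace_maximal[OF representation_carrier[OF \<rho> g]
      representation_finite_order[OF G \<rho> g] this tr]
  obtain d where d: "\<rho> g = d \<cdot>\<^sub>m 1\<^sub>m n" by blast
  have "g \<otimes>\<^bsub>G\<^esub> h = h \<otimes>\<^bsub>G\<^esub> g" if h: "h \<in> carrier G" for h
  proof -
    have "\<rho> (g \<otimes>\<^bsub>G\<^esub> h) = \<rho> (h \<otimes>\<^bsub>G\<^esub> g)"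
      using representation_carrier[OF \<rho> h] representation_mult[OF \<rho> g h] representation_mult[OF \<rho> h g]
      by (simp add: d mult_smult_distrib[OF _ one_carrier_mat] mult_smult_assoc_mat[OF one_carrier_mat])
    then show ?thesis using \<open>faithful G \<rho>\<close> g h unfolding faithful_def inj_on_def by simp
  qed
  then have "g \<in> center G" using g by (simp add: center_def)
  then show "g \<in> {\<one>\<^bsub>G\<^esub>}" using \<open>center G = {\<one>\<^bsub>G\<^esub>}\<close> by simp
qed

lemma one_in_scalar_subgroup:
  assumes "group G" "representation G n \<rho>"
  shows "\<one>\<^bsub>G\<^esub> \<in> scalar_subgroup G (group_character \<rho>) n"
  using group.is_monoid[OF assms(1), THEN monoid.one_closed] representation_one[OF assms]
  by (simp add: scalar_subgroup_def level_set_def group_character_def mat_trace_def)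

section \<open>Power sums over level sets\<close>

text \<open>
  Discard every element outside \<open>K\<close> and the first \<open>i + 1\<close> level sets, and on the latter replace \<open>|\<chi>|\<close> by
  its smallest value \<open>\<gamma> i\<close>.
\<close>
lemma sum_powr_level_sets_le:
  assumes fin: "finite (carrier G)" and \<gamma>: "lists_abs_values G \<chi> n \<gamma> l"
    and i: "i \<le> l" and t: "t > 0"
  shows "\<gamma> i powr t * (\<Sum>q\<le>i. real (card (level_set G \<chi> (\<gamma> q))))
           \<le> (\<Sum>g\<in>carrier G. cmod (\<chi> g) powr t) - real n powr t * real (card (scalar_subgroup G \<chi> n))"
proof -
  have dec: "\<gamma> a > \<gamma> b" if "a < b" "b \<le> l" for a b
    using \<gamma> that unfolding lists_abs_values_def by blast
  have n: "\<gamma> q < real n" if "q \<le> l" for q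
    using \<gamma> dec[of 0 q] that unfolding lists_abs_values_def
    by (cases "q = 0") (auto intro: less_trans[of _ "\<gamma> 0"])
  have "\<gamma> i \<in> (\<lambda>g. cmod (\<chi> g)) ` carrier G"
    using \<gamma> i unfolding lists_abs_values_def by auto
  then have pos: "\<gamma> i \<ge> 0" by auto
  let ?L = "\<lambda>q. level_set G \<chi> (\<gamma> q)" and ?K = "scalar_subgroup G \<chi> n"
  have fL: "finite (level_set G \<chi> c)" for c using fin by (simp add: level_set_def)
  have disj: "?L a \<inter> ?L b = {}" if "a \<le> i" "b \<le> i" "a \<noteq> b" for a b
    using dec[of a b] dec[of b a] that i by (cases a b rule: linorder_cases) (auto simp: level_set_def)
  have disjK: "?K \<inter> (\<Union>q\<le>i. ?L q) = {}"
  proof -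
    have "\<gamma> q \<noteq> real n" if "q \<le> i" for q using n[of q] i that by simp
    then show ?thesis by (fastforce simp: level_set_def scalar_subgroup_def)
  qed
  have "\<gamma> i powr t * (\<Sum>q\<le>i. real (card (?L q))) = (\<Sum>q\<le>i. \<Sum>g\<in>?L q. \<gamma> i powr t)"
    by (simp add: sum_distrib_left mult.commute)
  also have "\<dots> = (\<Sum>g\<in>(\<Union>q\<le>i. ?L q). \<gamma> i powr t)"
    using fL disj by (intro sum.UNION_disjoint[symmetric]) auto
  also have "\<dots> \<le> (\<Sum>g\<in>(\<Union>q\<le>i. ?L q). cmod (\<chi> g) powr t)"
  proof (rule sum_mono)
    fix g assume "g \<in> (\<Union>q\<le>i. ?L q)"
    then obtain q where q: "q \<le> i" "cmod (\<chi> g) = \<gamma> q" by (auto simp: level_set_def)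
    then have "\<gamma> i \<le> cmod (\<chi> g)" using dec[of q i] i by (cases "q = i") auto
    then show "\<gamma> i powr t \<le> cmod (\<chi> g) powr t" using pos t by (intro powr_mono2) auto
  qed
  finally have "\<gamma> i powr t * (\<Sum>q\<le>i. real (card (?L q))) + (\<Sum>g\<in>?K. cmod (\<chi> g) powr t)
      \<le> (\<Sum>g\<in>?K \<union> (\<Union>q\<le>i. ?L q). cmod (\<chi> g) powr t)"
    using disjK fL by (subst sum.union_disjoint) (auto simp: scalar_subgroup_def)
  also have "\<dots> \<le> (\<Sum>g\<in>carrier G. cmod (\<chi> g) powr t)"
    using fin by (intro sum_mono2) (auto simp: level_set_def scalar_subgroup_def)
  also have "(\<Sum>g\<in>?K. cmod (\<chi> g) powr t) = real n powr t * real (card ?K)"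
    by (simp add: level_set_def scalar_subgroup_def)
  finally show ?thesis by simp
qed

text \<open>
  Each \<open>\<gamma> q\<close> is attained, so the denominators of the bounds are positive.
\<close>
lemma sum_level_sets_pos:
  assumes fin: "finite (carrier G)" and \<gamma>: "lists_abs_values G \<chi> n \<gamma> l" and i: "i \<le> l"
  shows "(\<Sum>q\<le>i. real (card (level_set G \<chi> (\<gamma> q)))) > 0"
proof -
  have "\<gamma> i \<in> (\<lambda>g. cmod (\<chi> g)) ` carrier G"
    using \<gamma> i unfolding lists_abs_values_def by auto
  then have "level_set G \<chi> (\<gamma> i) \<noteq> {}" by (auto simp: level_set_def)
  then have "card (level_set G \<chi> (\<gamma> i)) > 0" using fin by (simp add: card_gt_0_iff level_set_def)
  then show ?thesis by (intro sum_pos2[of _ i]) auto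
qed

lemma abs_value_le_powr_mean:
  assumes G: "finite (carrier G)" and \<gamma>: "lists_abs_values G \<chi> n \<gamma> l"
    and i: "i \<le> l" and t: "t > 0"
  shows "\<gamma> i \<le> ((trivial_coeff G \<chi> t
      - real n powr t * real (card (scalar_subgroup G \<chi> n)) / real (card (carrier G))) /
     ((\<Sum>q\<le>i. real (card (level_set G \<chi> (\<gamma> q)))) / real (card (carrier G)))) powr (1 / t)"
proof -
  define s where "s = (\<Sum>q\<le>i. real (card (level_set G \<chi> (\<gamma> q))))"
  define S where "S = (\<Sum>g\<in>carrier G. cmod (\<chi> g) powr t)"
  define k where "k = real n powr t * real (card (scalar_subgroup G \<chi> n))"
  have s: "s > 0" using sum_level_sets_pos[OF G \<gamma> i] by (simp add: s_def)
  have attained: "\<gamma> i \<in> (\<lambda>g. cmod (\<chi> g)) ` carrier G"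
    using \<gamma> i unfolding lists_abs_values_def by auto
  then have pos: "\<gamma> i \<ge> 0" by auto
  have c: "real (card (carrier G)) > 0" using attained G by (auto simp: card_gt_0_iff)
  have "\<gamma> i powr t \<le> (S - k) / s"
    using sum_powr_level_sets_le[OF G \<gamma> i t] s by (simp add: field_simps s_def S_def k_def)
  then have "(\<gamma> i powr t) powr (1 / t) \<le> ((S - k) / s) powr (1 / t)"
    using t by (intro powr_mono2) auto
  also have "(\<gamma> i powr t) powr (1 / t) = \<gamma> i" using pos t by (simp add: powr_powr)
  also have "(S - k) / s = (S / real (card (carrier G)) - k / real (card (carrier G))) / (s / real (card (carrier G)))"
    using c s by (simp add: field_simps)
  finally show ?thesis by (simp add: trivial_coeff_def s_def S_def k_def)
qed

text \<open>
  Besides \<open>x\<close>, which contributes \<open>n\<^sup>2\<close>, only the elements outside the zero set contribute to the sum of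
  squares, and \<open>\<gamma> 0\<close> is the largest value of \<open>|\<chi>|\<close> on those.  An element at which \<open>\<gamma> 0 > 0\<close> is attained
  shows that there is at least one such element, so that the bound may be divided by their number.
\<close>
lemma sum_squares_le_max_level:
  assumes G: "finite (carrier G)" and \<gamma>: "lists_abs_values G \<chi> n \<gamma> l"
    and K: "scalar_subgroup G \<chi> n = {x}"
  shows "(\<Sum>g\<in>carrier G. (cmod (\<chi> g))\<^sup>2) - (real n)\<^sup>2
           \<le> (\<gamma> 0)\<^sup>2 * (real (card (carrier G)) - real (card (zero_set G \<chi>)) - 1)"
    and "\<gamma> 0 > 0 \<Longrightarrow> real (card (carrier G)) - real (card (zero_set G \<chi>)) - 1 > 0"
proof -
  let ?Z = "zero_set G \<chi>"
  let ?R = "carrier G - {x} - ?Z"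
  have n: "real n > 0"
  proof -
    have "\<gamma> 0 \<in> (\<lambda>g. cmod (\<chi> g)) ` carrier G" using \<gamma> unfolding lists_abs_values_def by auto
    then have "\<gamma> 0 \<ge> 0" by auto
    then show ?thesis using \<gamma> unfolding lists_abs_values_def by linarith
  qed
  have one: "x \<in> carrier G" and x: "cmod (\<chi> x) = real n" using K by (auto simp: scalar_subgroup_def level_set_def)
  then have xZ: "x \<notin> ?Z" using n by (auto simp: zero_set_def)
  have fZ: "finite ?Z" and ZG: "?Z \<subseteq> carrier G" using G by (auto simp: zero_set_def)
  have "card (carrier G - insert x ?Z) = card (carrier G) - card (insert x ?Z)"
    using one ZG fZ by (intro card_Diff_subset) auto
  moreover have "card (insert x ?Z) \<le> card (carrier G)"
    using one ZG G by (intro card_mono) auto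
  moreover have "?R = carrier G - insert x ?Z" by auto
  ultimately have cR: "real (card ?R) = real (card (carrier G)) - real (card ?Z) - 1"
    using xZ fZ by (simp add: of_nat_diff)
  have "(\<Sum>g\<in>carrier G. (cmod (\<chi> g))\<^sup>2) = (real n)\<^sup>2 + (\<Sum>g\<in>carrier G - {x}. (cmod (\<chi> g))\<^sup>2)"
    using sum.remove[OF G one, of "\<lambda>g. (cmod (\<chi> g))\<^sup>2"] x by simp
  also have "(\<Sum>g\<in>carrier G - {x}. (cmod (\<chi> g))\<^sup>2) = (\<Sum>g\<in>?R. (cmod (\<chi> g))\<^sup>2)"
    using G by (intro sum.mono_neutral_right) (auto simp: zero_set_def)
  also have "\<dots> \<le> (\<Sum>g\<in>?R. (\<gamma> 0)\<^sup>2)"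
  proof (intro sum_mono power_mono)
    fix g assume g: "g \<in> ?R"
    then have "g \<notin> scalar_subgroup G \<chi> n" using K by simp
    then have "cmod (\<chi> g) \<noteq> real n" using g by (auto simp: scalar_subgroup_def level_set_def)
    moreover have "cmod (\<chi> g) \<in> insert (real n) (\<gamma> ` {..l})"
      using \<gamma> g unfolding lists_abs_values_def by blast
    ultimately obtain q where q: "q \<le> l" "cmod (\<chi> g) = \<gamma> q" by auto
    then show "cmod (\<chi> g) \<le> \<gamma> 0"
      using \<gamma> unfolding lists_abs_values_def by (cases "q = 0") (auto intro: less_imp_le)
  qed auto
  finally show "(\<Sum>g\<in>carrier G. (cmod (\<chi> g))\<^sup>2) - (real n)\<^sup>2
           \<le> (\<gamma> 0)\<^sup>2 * (real (card (carrier G)) - real (card (zero_set G \<chi>)) - 1)"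
    using cR by (simp add: mult.commute)
  assume "\<gamma> 0 > 0"
  have "\<gamma> 0 \<in> (\<lambda>g. cmod (\<chi> g)) ` carrier G" using \<gamma> unfolding lists_abs_values_def by auto
  then obtain g where g: "g \<in> carrier G" "cmod (\<chi> g) = \<gamma> 0" by auto
  have "\<gamma> 0 < real n" using \<gamma> unfolding lists_abs_values_def by blast
  then have "g \<in> ?R" using g x \<open>\<gamma> 0 > 0\<close> by (auto simp: zero_set_def)
  then have "card ?R > 0" using G by (auto simp: card_gt_0_iff)
  then show "real (card (carrier G)) - real (card (zero_set G \<chi>)) - 1 > 0" using cR by linarith
qed

theorem corollary1p2:
  fixes G :: "('a, 'b) monoid_scheme"
    and \<rho> :: "'a \<Rightarrow> complex mat"
    and \<chi> :: "'a \<Rightarrow> complex"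
    and n l :: nat
    and \<gamma> :: "nat \<Rightarrow> real"
    and C :: "nat \<Rightarrow> 'a set"
    and K G\<^sub>0 :: "'a set"
  assumes "group G" and "finite (carrier G)" and "\<not> comm_group G"
    and "irreducible_representation G n \<rho>" and "n > 1"
    and "\<chi> = group_character \<rho>"
    and "K = scalar_subgroup G \<chi> n"
    and "G\<^sub>0 = zero_set G \<chi>"
    and "lists_abs_values G \<chi> n \<gamma> l"
    and "\<gamma> 0 > 0"
    and "C = (\<lambda>q. level_set G \<chi> (\<gamma> q))"
  shows "(\<forall>i\<le>l. \<forall>t>0. \<gamma> i \<le>
            ((trivial_coeff G \<chi> t - real n powr t * real (card K) / real (card (carrier G))) /
             ((\<Sum>q\<le>i. real (card (C q))) / real (card (carrier G)))) powr (1 / t))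
       \<and> (faithful G \<rho> \<and> center G = {\<one>\<^bsub>G\<^esub>} \<longrightarrow>
           (\<forall>i\<le>l. \<gamma> i \<le> sqrt ((real (card (carrier G)) - (real n)\<^sup>2) / (\<Sum>q\<le>i. real (card (C q)))))
         \<and> sqrt ((real (card (carrier G)) - (real n)\<^sup>2) / (real (card (carrier G)) - real (card G\<^sub>0) - 1)) \<le> \<gamma> 0
         \<and> \<gamma> 0 \<le> sqrt ((real (card (carrier G)) - (real n)\<^sup>2) / real (card (C 0))))"
proof -
  let ?c = "real (card (carrier G))"
  have powr: "\<gamma> i \<le> ((trivial_coeff G \<chi> t - real n powr t * real (card K) / ?c) /
      ((\<Sum>q\<le>i. real (card (C q))) / ?c)) powr (1 / t)" if "i \<le> l" "t > 0" for i t
    using abs_value_le_powr_mean[OF assms(2,9) that] assms(7,11) by simp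
  have "(\<forall>i\<le>l. \<gamma> i \<le> sqrt ((?c - (real n)\<^sup>2) / (\<Sum>q\<le>i. real (card (C q)))))
      \<and> sqrt ((?c - (real n)\<^sup>2) / (?c - real (card G\<^sub>0) - 1)) \<le> \<gamma> 0"
    if faithful: "faithful G \<rho>" and center: "center G = {\<one>\<^bsub>G\<^esub>}"
  proof
    have \<rho>: "representation G n \<rho>" using assms(4) unfolding irreducible_representation_def by auto
    have K: "scalar_subgroup G \<chi> n = {\<one>\<^bsub>G\<^esub>}"
      using scalar_subgroup_trivial[OF assms(1,2,4) faithful center]
        one_in_scalar_subgroup[OF assms(1) \<rho>] assms(6) by blast
    have norm: "(\<Sum>g\<in>carrier G. (cmod (\<chi> g))\<^sup>2) = ?c"
      using sum_norm_character_squared[OF assms(1,2,4)] assms(6) by simp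
    show "\<forall>i\<le>l. \<gamma> i \<le> sqrt ((?c - (real n)\<^sup>2) / (\<Sum>q\<le>i. real (card (C q))))"
    proof (intro allI impI real_le_rsqrt)
      fix i assume i: "i \<le> l"
      have "\<gamma> i \<in> (\<lambda>g. cmod (\<chi> g)) ` carrier G"
        using assms(9) i unfolding lists_abs_values_def by auto
      then have "\<gamma> i \<ge> 0" by auto
      then have "(\<gamma> i)\<^sup>2 * (\<Sum>q\<le>i. real (card (C q))) \<le> ?c - (real n)\<^sup>2"
        using sum_powr_level_sets_le[OF assms(2,9) i, of 2] norm assms(5,11) by (simp add: K)
      then show "(\<gamma> i)\<^sup>2 \<le> (?c - (real n)\<^sup>2) / (\<Sum>q\<le>i. real (card (C q)))"
        using sum_level_sets_pos[OF assms(2,9) i] assms(11) by (simp add: field_simps)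
    qed
    show "sqrt ((?c - (real n)\<^sup>2) / (?c - real (card G\<^sub>0) - 1)) \<le> \<gamma> 0"
      using sum_squares_le_max_level[OF assms(2,9) K] norm assms(8,10)
      by (intro real_le_lsqrt) (auto simp: divide_le_eq)
  qed
  moreover have "\<gamma> 0 \<le> sqrt ((?c - (real n)\<^sup>2) / real (card (C 0)))"
    if "\<forall>i\<le>l. \<gamma> i \<le> sqrt ((?c - (real n)\<^sup>2) / (\<Sum>q\<le>i. real (card (C q))))"
    using that[rule_format, of 0] by simp
  ultimately show ?thesis using powr by blast
qed

end
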